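(* For every integer $s \geq 2$, the polynomials \[ F_{1/s}(x,y) = \frac{(x-(s-1)y)^2}{2} + \frac{x+(3-s)y}{2} \] and \[ G_{1/s}(x,y) = \frac{(x-(s-1)y)^2}{2} + \frac{3x+(1-3s)y}{2} \] are the unique quadratic packing polynomials on the integer sector $I(1/s) = \{(x,y)\in\mathbf{N}_0^2 : 0 \le y \le x/s\}$; that is, the set of all quadratic packing polynomials on $I(1/s)$ is exactly $\{F_{1/s}, G_{1/s}\}$.
   Context: $\mathbf{N}_0$ denotes the set of nonnegative integers. A packing polynomial on an integer sector $I \subseteq \mathbf{N}_0^2$ is a polynomial in two variables (with real coefficients) whose restriction to $I$ is a one-to-one correspondence between $I$ and $\mathbf{N}_0$. Quadratic means of total degree two. *)

theory Defs
  imports Complex_Main "HOL-Computational_Algebra.Polynomial"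
begin

text \<open>
  A real polynomial in two variables \<open>x\<close>, \<open>y\<close> is an element of \<open>real poly poly\<close>, read as a
  polynomial in \<open>y\<close> whose coefficients are polynomials in \<open>x\<close>; the coefficient of
  \<open>x ^ i * y ^ j\<close> in \<open>p\<close> is \<open>coeff (coeff p j) i\<close>.
\<close>

definition var_x :: "real poly poly" where
  "var_x = [:[:0, 1:]:]"

definition var_y :: "real poly poly" where
  "var_y = [:0, 1:]"

definition eval2 :: "real poly poly \<Rightarrow> real \<Rightarrow> real \<Rightarrow> real" where
  "eval2 p x y = poly (poly p [:y:]) x"

definition monomial_degrees :: "real poly poly \<Rightarrow> nat set" where
  "monomial_degrees p = {i + j | i j. coeff (coeff p j) i \<noteq> 0}"

text \<open>The zero polynomial gets total degree \<open>0\<close>.\<close>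

definition total_degree :: "real poly poly \<Rightarrow> nat" where
  "total_degree p = Max (insert 0 (monomial_degrees p))"

definition sector :: "real \<Rightarrow> (nat \<times> nat) set" where
  "sector \<alpha> = {(x, y). real y \<le> \<alpha> * real x}"

text \<open>Below, \<open>\<nat>\<close> is the set of nonnegative integers as a subset of the reals.\<close>

definition packing_polynomial :: "real poly poly \<Rightarrow> (nat \<times> nat) set \<Rightarrow> bool" where
  "packing_polynomial p I \<longleftrightarrow> bij_betw (\<lambda>(x, y). eval2 p (real x) (real y)) I (\<nat> :: real set)"

definition quadratic_packing_polynomials :: "(nat \<times> nat) set \<Rightarrow> real poly poly set" where
  "quadratic_packing_polynomials I = {p. total_degree p = 2 \<and> packing_polynomial p I}"

definition F_inv :: "int \<Rightarrow> real poly poly" where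
  "F_inv s = smult [:1/2:] ((var_x - of_int (s - 1) * var_y)^2)
           + smult [:1/2:] (var_x + of_int (3 - s) * var_y)"

definition G_inv :: "int \<Rightarrow> real poly poly" where
  "G_inv s = smult [:1/2:] ((var_x - of_int (s - 1) * var_y)^2)
           + smult [:1/2:] (3 * var_x + of_int (1 - 3 * s) * var_y)"

lemma finite_monomial_degrees: "finite (monomial_degrees p)"
proof -
  define N where "N = Max ((\<lambda>j. degree (coeff p j)) ` {..degree p})"
  have "monomial_degrees p \<subseteq> {..N + degree p}"
  proof
    fix d assume "d \<in> monomial_degrees p"
    then obtain i j where d: "d = i + j" and nz: "coeff (coeff p j) i \<noteq> 0"
      by (auto simp: monomial_degrees_def)
    have "coeff p j \<noteq> 0" using nz by auto
    then have j: "j \<le> degree p" by (rule le_degree)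
    then have "degree (coeff p j) \<le> N"
      unfolding N_def by (intro Max_ge) auto
    with le_degree[OF nz] j show "d \<in> {..N + degree p}" by (simp add: d)
  qed
  then show ?thesis by (rule finite_subset) simp
qed

lemma eval2_simps [simp]:
  "eval2 var_x x y = x"
  "eval2 var_y x y = y"
  "eval2 (p + q) x y = eval2 p x y + eval2 q x y"
  "eval2 (p - q) x y = eval2 p x y - eval2 q x y"
  "eval2 (p * q) x y = eval2 p x y * eval2 q x y"
  "eval2 (p ^ n) x y = eval2 p x y ^ n"
  "eval2 (smult [:c:] p) x y = c * eval2 p x y"
  "eval2 1 x y = 1"
  "eval2 (of_int k) x y = of_int k"
  "eval2 (numeral m) x y = numeral m"
  by (simp_all add: eval2_def var_x_def var_y_def poly_power)

lemma eval2_F_inv: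
  "eval2 (F_inv s) x y = (x - (of_int s - 1) * y)^2 / 2 + (x + (3 - of_int s) * y) / 2"
  by (simp add: F_inv_def)

lemma eval2_G_inv:
  "eval2 (G_inv s) x y = (x - (of_int s - 1) * y)^2 / 2 + (3 * x + (1 - 3 * of_int s) * y) / 2"
  by (simp add: G_inv_def)

end

theory Submission
  imports Defs "HOL-Library.FuncSet" "HOL-Library.Nat_Bijection"
begin

text \<open>
  The map \<open>(a, b) \<mapsto> (a + s b, b)\<close> is a bijection from \<open>\<nat>\<^sup>2\<close> onto the sector, so the claim is the
  Fueter-Polya theorem for quadratic polynomials on \<open>\<nat>\<^sup>2\<close>, with \<open>F\<close> and \<open>G\<close> corresponding to the
  two Cantor polynomials. Twice a packing polynomial has integer coefficients. A quadratic
  polynomial takes equal values at two points that are symmetric about \<open>z\<close> and whose difference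
  is orthogonal to the gradient at \<open>z\<close>. Moving \<open>z\<close> to infinity along a ray on which the gradient
  keeps its direction produces such a pair inside the quadrant whenever the quadratic form is
  nondegenerate, or degenerate with nonpositive mixed coefficient. In the
  remaining case \<open>A C = B\<^sup>2\<close> with \<open>A, B, C > 0\<close>, counting lattice points in a triangle shows that
  surjectivity forces \<open>B = 1\<close>, hence \<open>A = C = 1\<close>. The linear part is then found by looking for
  collisions and gaps between consecutive diagonals \<open>a + b = t\<close>.
\<close>

section \<open>Integer quadratics on the quadrant\<close>

text \<open>The integer quadratic stands for twice the packing polynomial, hence the even values in
  \<open>quad_onto\<close> below.\<close>

definition quad :: "int \<Rightarrow> int \<Rightarrow> int \<Rightarrow> int \<Rightarrow> int \<Rightarrow> int \<Rightarrow> int \<Rightarrow> int \<Rightarrow> int" where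
  "quad A B C p r f a b = A * a^2 + 2 * B * a * b + C * b^2 + p * a + r * b + f"

definition quad_inj :: "int \<Rightarrow> int \<Rightarrow> int \<Rightarrow> int \<Rightarrow> int \<Rightarrow> int \<Rightarrow> bool" where
  "quad_inj A B C p r f \<longleftrightarrow> inj_on (\<lambda>(a, b). quad A B C p r f a b) ({0..} \<times> {0..})"

definition quad_onto :: "int \<Rightarrow> int \<Rightarrow> int \<Rightarrow> int \<Rightarrow> int \<Rightarrow> int \<Rightarrow> bool" where
  "quad_onto A B C p r f \<longleftrightarrow>
     (\<lambda>(a, b). quad A B C p r f a b) ` ({0..} \<times> {0..}) = {n. 0 \<le> n \<and> even n}"

text \<open>Exchanging the axes transfers statements about \<open>A\<close> and \<open>p\<close> to
  \<open>C\<close> and \<open>r\<close>.\<close>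

lemma quad_swap: "quad A B C p r f a b = quad C B A r p f b a"
  by (simp add: quad_def algebra_simps)

lemma quad_injD:
  assumes "quad_inj A B C p r f" "quad A B C p r f a b = quad A B C p r f a' b'"
    and "0 \<le> a" "0 \<le> b" "0 \<le> a'" "0 \<le> b'"
  shows "a = a'" "b = b'"
  using assms(1)[unfolded quad_inj_def, THEN inj_onD, of "(a, b)" "(a', b')"] assms(2-) by auto

lemma quad_ontoD:
  assumes "quad_onto A B C p r f" "0 \<le> a" "0 \<le> b"
  shows "0 \<le> quad A B C p r f a b" "even (quad A B C p r f a b)"
proof -
  have "quad A B C p r f a b \<in> (\<lambda>(a, b). quad A B C p r f a b) ` ({0..} \<times> {0..})"
    using assms(2,3) by force
  then show "0 \<le> quad A B C p r f a b" "even (quad A B C p r f a b)"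
    using assms(1) by (auto simp: quad_onto_def)
qed

lemma quad_ontoE:
  assumes "quad_onto A B C p r f" "0 \<le> n" "even n"
  obtains a b where "0 \<le> a" "0 \<le> b" "quad A B C p r f a b = n"
proof -
  have "n \<in> (\<lambda>(a, b). quad A B C p r f a b) ` ({0..} \<times> {0..})"
    using assms by (simp add: quad_onto_def)
  then show thesis using that by auto
qed

lemma le_mult_pos_int:
  fixes c x :: int
  assumes "0 < c" "0 \<le> x"
  shows "x \<le> c * x"
  using mult_right_mono[of 1 c x] assms by simp

lemma quad_swap_comp:
  "(\<lambda>(a, b). quad C B A r p f a b) = (\<lambda>(a, b). quad A B C p r f a b) \<circ> prod.swap"
  by (auto simp: quad_swap[of C])

lemma quad_inj_swap:
  assumes "quad_inj A B C p r f"
  shows "quad_inj C B A r p f"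
  unfolding quad_inj_def quad_swap_comp[of C]
  by (rule comp_inj_on) (use assms in \<open>simp_all only: quad_inj_def product_swap inj_swap\<close>)

lemma quad_onto_swap:
  assumes "quad_onto A B C p r f"
  shows "quad_onto C B A r p f"
proof -
  have "(\<lambda>(a, b). quad C B A r p f a b) ` ({0..} \<times> {0..})
      = (\<lambda>(a, b). quad A B C p r f a b) ` prod.swap ` ({0..} \<times> {0..})"
    by (simp only: quad_swap_comp[of C] image_comp)
  then show ?thesis using assms by (simp only: quad_onto_def product_swap)
qed

section \<open>Collisions by point reflection\<close>

text \<open>Terms of even order in \<open>(h, k)\<close> cancel between the two reflected points,
  which leaves twice the derivative along \<open>(h, k)\<close>. The bounds keep both points in the
  quadrant.\<close>

lemma quad_inj_reflection:
  assumes inj: "quad_inj A B C p r f"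
    and orth: "h * (2 * (A * x + B * y) + p) + k * (2 * (B * x + C * y) + r) = 0"
    and "\<bar>h\<bar> \<le> x" "\<bar>k\<bar> \<le> y"
  shows "h = 0" "k = 0"
proof -
  have "quad A B C p r f (x + h) (y + k) - quad A B C p r f (x - h) (y - k)
      = 2 * (h * (2 * (A * x + B * y) + p) + k * (2 * (B * x + C * y) + r))"
    by (simp add: quad_def power2_eq_square algebra_simps)
  then have "quad A B C p r f (x + h) (y + k) = quad A B C p r f (x - h) (y - k)"
    using orth by simp
  from quad_injD[OF inj this] assms(3,4) show "h = 0" "k = 0" by auto
qed

text \<open>Moving from \<open>(x, y)\<close> in the direction \<open>(u, v)\<close> only rescales the gradient, so a single
  displacement orthogonal to it works arbitrarily far out in the quadrant.\<close>

lemma quad_inj_no_gradient_ray: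
  assumes inj: "quad_inj A B C p r f"
    and u: "A * u + B * v = m * (2 * (A * x + B * y) + p)"
    and v: "B * u + C * v = m * (2 * (B * x + C * y) + r)"
    and pos: "0 < u" "0 < v" "0 \<le> x" "0 \<le> y"
  shows "2 * (A * x + B * y) + p = 0" "2 * (B * x + C * y) + r = 0"
proof -
  define g h where "g = 2 * (A * x + B * y) + p" and "h = 2 * (B * x + C * y) + r"
  \<comment> \<open>After \<open>K\<close> steps along \<open>(u, v)\<close> the gradient is still a
    multiple of \<open>(g, h)\<close>, and both coordinates are at least \<open>K\<close>, so the
    orthogonal displacement \<open>(- h, g)\<close> fits.\<close>
  define K where "K = \<bar>g\<bar> + \<bar>h\<bar>"
  have "K \<ge> 0" by (simp add: K_def)
  have K: "K \<le> K * u" "K \<le> K * v"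
    using le_mult_pos_int[of u K] le_mult_pos_int[of v K] pos(1,2) \<open>K \<ge> 0\<close>
    by (simp_all add: mult.commute)
  have "2 * (A * (x + K * u) + B * (y + K * v)) + p = g + 2 * K * (A * u + B * v)"
    by (simp add: g_def algebra_simps)
  then have 1: "2 * (A * (x + K * u) + B * (y + K * v)) + p = (1 + 2 * K * m) * g"
    unfolding u g_def by (simp add: algebra_simps)
  have "2 * (B * (x + K * u) + C * (y + K * v)) + r = h + 2 * K * (B * u + C * v)"
    by (simp add: h_def algebra_simps)
  then have 2: "2 * (B * (x + K * u) + C * (y + K * v)) + r = (1 + 2 * K * m) * h"
    unfolding v h_def by (simp add: algebra_simps)
  have "\<bar>- h\<bar> \<le> x + K * u" "\<bar>g\<bar> \<le> y + K * v"
    using K pos(3,4) abs_ge_zero[of g] abs_ge_zero[of h] unfolding K_def by linarith+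
  then have "- h = 0" "g = 0"
    using quad_inj_reflection[OF inj, of "- h" "x + K * u" "y + K * v" g]
    unfolding 1 2 by simp_all
  then show "2 * (A * x + B * y) + p = 0" "2 * (B * x + C * y) + r = 0"
    by (simp_all add: g_def h_def)
qed

text \<open>A nonzero determinant gives a unique critical point, and the gradient keeps its
  direction on every ray from there. The ray through a far point \<open>(t, t)\<close> has positive
  direction.\<close>

lemma quad_inj_degenerate:
  assumes inj: "quad_inj A B C p r f"
  shows "A * C = B^2"
proof (rule ccontr)
  assume "A * C \<noteq> B^2"
  define d where "d = A * C - B^2"
  have d: "d \<noteq> 0" using \<open>A * C \<noteq> B^2\<close> by (simp add: d_def)
  define e1 e2 where "e1 = d * (C * p - B * r)" and "e2 = d * (A * r - B * p)"
  define t where "t = \<bar>e1\<bar> + \<bar>e2\<bar> + 1"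
  define g h where "g = 2 * (A * t + B * t) + p" and "h = 2 * (B * t + C * t) + r"
  \<comment> \<open>\<open>d\<close> times the adjugate matrix applied to the gradient, which is
    \<open>2 * d^2\<close> times the vector from the critical point to \<open>(t, t)\<close>. The
    extra factor \<open>d\<close> makes the scaling positive.\<close>
  define u v where "u = d * (C * g - B * h)" and "v = d * (A * h - B * g)"
  have u: "u = 2 * d^2 * t + e1" and v: "v = 2 * d^2 * t + e2"
    by (simp_all add: u_def v_def e1_def e2_def g_def h_def d_def power2_eq_square algebra_simps)
  have "0 < d^2" using d by simp
  then have "t \<le> d^2 * t" by (intro le_mult_pos_int) (simp_all add: t_def)
  moreover have "\<bar>e1\<bar> < t" "\<bar>e2\<bar> < t" "2 * d^2 * t = 2 * (d^2 * t)" by (simp_all add: t_def)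
  ultimately have "0 < u" "0 < v" unfolding u v by linarith+
  have "A * u + B * v = d^2 * g" "B * u + C * v = d^2 * h"
    by (simp_all add: u_def v_def d_def power2_eq_square algebra_simps)
  then have "g = 0" "h = 0"
    using quad_inj_no_gradient_ray[OF inj, of u v "d^2" t t] \<open>0 < u\<close> \<open>0 < v\<close>
    by (auto simp: g_def h_def t_def)
  with \<open>0 < u\<close> show False by (simp add: u_def)
qed

text \<open>For \<open>B = C = 0\<close> the gradient \<open>(2 * A * x + p, r)\<close> is
  independent of \<open>y\<close>, so a large \<open>y\<close> makes room for an orthogonal
  displacement.\<close>

lemma quad_inj_nonzero_right:
  assumes inj: "quad_inj A 0 C p r f" and "A > 0"
  shows "C \<noteq> 0"
proof
  assume "C = 0"
  define x where "x = \<bar>r\<bar> + \<bar>p\<bar> + 1"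
  define g where "g = 2 * A * x + p"
  have "x \<le> A * x" using \<open>A > 0\<close> by (intro le_mult_pos_int) (simp_all add: x_def)
  moreover have "\<bar>p\<bar> < x" "2 * A * x = 2 * (A * x)" by (simp_all add: x_def)
  ultimately have "g > 0" unfolding g_def by linarith
  then show False
    using quad_inj_reflection[OF inj, of "- r" x "\<bar>g\<bar>" g] \<open>C = 0\<close>
    by (simp add: g_def x_def algebra_simps)
qed

text \<open>The kernel vector \<open>(- B, A)\<close> of the degenerate form would be positive for
  \<open>B < 0\<close>. The gradient is constant along it, so its first component would vanish at
  every \<open>(x, 0)\<close>.\<close>

lemma quad_inj_cross_nonneg:
  assumes inj: "quad_inj A B C p r f" and "A > 0"
  shows "B \<ge> 0"
proof (rule ccontr)
  assume "\<not> B \<ge> 0"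
  have deg: "A * C = B^2" by (rule quad_inj_degenerate[OF inj])
  have *: "2 * (A * x + B * 0) + p = 0" if "0 \<le> x" for x
    using quad_inj_no_gradient_ray(1)[OF inj, of "- B" A 0 x 0] \<open>A > 0\<close> \<open>\<not> B \<ge> 0\<close> deg that
    by (simp add: power2_eq_square algebra_simps)
  from *[of 0] *[of 1] \<open>A > 0\<close> show False by simp
qed

section \<open>Surjectivity and lattice point counting\<close>

lemma quad_onto_leading_nonneg:
  assumes "quad_onto A B C p r f"
  shows "A \<ge> 0"
proof (rule ccontr)
  assume "\<not> A \<ge> 0"
  \<comment> \<open>Chosen so that \<open>a^2\<close> outweighs \<open>p * a + f\<close>.\<close>
  define a where "a = \<bar>p\<bar> + \<bar>f\<bar> + 1"
  have "a \<ge> 1" by (simp add: a_def)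
  have "A * a^2 \<le> (-1) * a^2"
    using \<open>\<not> A \<ge> 0\<close> by (intro mult_right_mono) auto
  moreover have "a^2 = \<bar>p\<bar> * a + \<bar>f\<bar> * a + a"
    by (simp add: a_def power2_eq_square algebra_simps)
  moreover have "p * a \<le> \<bar>p\<bar> * a" using \<open>a \<ge> 1\<close> by (intro mult_right_mono) auto
  moreover have "\<bar>f\<bar> \<le> \<bar>f\<bar> * a"
    using le_mult_pos_int[of a "\<bar>f\<bar>"] \<open>a \<ge> 1\<close> by (simp add: mult.commute)
  ultimately have "A * a^2 + p * a + f < 0"
    using \<open>a \<ge> 1\<close> by linarith
  then have "quad A B C p r f a 0 < 0" by (simp add: quad_def)
  with quad_ontoD(1)[OF assms, of a 0] \<open>a \<ge> 1\<close> show False by simp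
qed

text \<open>The point reflection of the enclosing rectangle swaps the triangle with its complement,
  up to the diagonal.\<close>

lemma card_lattice_triangle_le:
  fixes A B k :: int
  assumes "A > 0" "B > 0" "k \<ge> 0"
  defines "S \<equiv> {(a, b). 0 \<le> a \<and> 0 \<le> b \<and> A * a + B * b \<le> A * B * k}"
  shows "finite S" "2 * int (card S) \<le> (B * k + 1) * (A * k + 2)"
proof -
  define R where "R = {0..B * k} \<times> {0..A * k}"
  define S' where "S' = (\<lambda>(a, b). (B * k - a, A * k - b)) ` S"
  have fin: "finite R" by (simp add: R_def)
  have SR: "S \<subseteq> R"
  proof (clarsimp simp: S_def R_def)
    fix a b assume ab: "0 \<le> a" "0 \<le> b" "A * a + B * b \<le> A * B * k"
    have "0 \<le> A * a" "0 \<le> B * b" using ab assms by auto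
    then have "A * a \<le> A * (B * k)" "B * b \<le> B * (A * k)" using ab by (simp_all add: mult_ac)
    then show "a \<le> B * k \<and> b \<le> A * k" using assms by simp
  qed
  then show "finite S" using fin by (rule finite_subset)
  have S'R: "S' \<subseteq> R" using SR by (force simp: S'_def R_def S_def)
  have cS': "card S' = card S"
    unfolding S'_def by (rule card_image) (auto intro!: inj_onI)
  have cover: "R \<subseteq> S \<union> S'"
  proof (clarsimp simp: R_def)
    fix a b assume ab: "0 \<le> a" "a \<le> B * k" "0 \<le> b" "b \<le> A * k" "(a, b) \<notin> S'"
    show "(a, b) \<in> S"
    proof (rule ccontr)
      assume "(a, b) \<notin> S"
      then have "(B * k - a, A * k - b) \<in> S"
        using ab by (auto simp: S_def algebra_simps)
      then have "(a, b) \<in> S'" by (force simp: S'_def)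
      with ab show False by simp
    qed
  qed
  have diag: "A * a + B * b = A * B * k" if "(a, b) \<in> S \<inter> S'" for a b
    using that by (auto simp: S_def S'_def algebra_simps)
  \<comment> \<open>The overlap lies on the hypotenuse, where the first coordinate determines the
    point.\<close>
  have "inj_on fst (S \<inter> S')"
  proof (rule inj_onI, clarify)
    fix a b a' b'
    assume 1: "(a, b) \<in> S" "(a, b) \<in> S'" "(a', b') \<in> S" "(a', b') \<in> S'"
      and "fst (a, b) = fst (a', b')"
    then have "a = a'" by simp
    moreover have "B * b = B * b'" using diag[of a b] diag[of a' b'] 1 \<open>a = a'\<close>
      by (metis IntI add_left_cancel)
    then have "b = b'" using \<open>B > 0\<close> by simp
    ultimately show "a = a' \<and> b = b'" by simp
  qed
  moreover have "fst ` (S \<inter> S') \<subseteq> {0..B * k}" using SR by (auto simp: R_def)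
  ultimately have "card (S \<inter> S') \<le> card {0..B * k}" by (intro card_inj_on_le) auto
  then have "int (card (S \<inter> S')) \<le> B * k + 1"
    using assms by (simp add: le_nat_iff)
  moreover have "int (card S + card S') = int (card (S \<union> S') + card (S \<inter> S'))"
    using card_Un_Int[OF finite_subset[OF SR fin] finite_subset[OF S'R fin]] by linarith
  moreover have "S \<union> S' = R" using SR S'R cover by blast
  moreover have "int (card R) = (B * k + 1) * (A * k + 1)"
    using assms by (simp add: R_def card_cartesian_product)
  ultimately show "2 * int (card S) \<le> (B * k + 1) * (A * k + 2)"
    by (simp add: cS' algebra_simps)
qed

text \<open>The set where the form is at most \<open>n\<close> contains about \<open>n / B\<close> lattice points, too few
  to attain all values unless \<open>B = 1\<close>.\<close>

lemma quad_onto_parabolic_cross_eq_1: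
  assumes onto: "quad_onto A B C p r f"
    and deg: "A * C = B^2" and "A > 0" "B > 0"
  shows "B = 1"
proof (rule ccontr)
  assume "B \<noteq> 1"
  then have "B \<ge> 2" using \<open>B > 0\<close> by simp
  define m where "m = \<bar>p\<bar> + \<bar>r\<bar>"
  \<comment> \<open>\<open>q\<close> collects the terms linear in \<open>k\<close> of the final
    comparison, \<open>k\<close> makes \<open>k * k\<close> exceed
    \<open>q * k + 3 + \<bar>f\<bar>\<close>, and \<open>V\<close> is a lower bound for the values
    outside \<open>S\<close>.\<close>
  define q where "q = A * B * m + 2 * B + A"
  define k where "k = q + 4 + \<bar>f\<bar>"
  define V where "V = B * k * (A * B * k - A * m) - \<bar>f\<bar>"
  define S where "S = {(a, b). 0 \<le> a \<and> 0 \<le> b \<and> A * a + B * b \<le> A * B * k}"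
  have m: "m \<ge> 0" by (simp add: m_def)
  have "A * B \<ge> 1" using \<open>A > 0\<close> \<open>B > 0\<close> by (simp add: int_one_le_iff_zero_less)
  have q: "q \<ge> 0" using \<open>A > 0\<close> \<open>B > 0\<close> m by (simp add: q_def)
  then have k: "k > 0" by (simp add: k_def)
  have "m \<le> A * B * m" using \<open>A * B \<ge> 1\<close> m by (intro le_mult_pos_int) auto
  then have "m \<le> k" using \<open>A > 0\<close> \<open>B > 0\<close> by (simp add: k_def q_def)
  moreover have "k \<le> B * k" using \<open>B > 0\<close> k by (intro le_mult_pos_int) auto
  ultimately have "A * m \<le> A * (B * k)" using \<open>A > 0\<close> by simp
  then have Amk: "0 \<le> A * B * k - A * m" by (simp add: mult_ac)
  have big: "V \<le> quad A B C p r f a b" if "0 \<le> a" "0 \<le> b" "(a, b) \<notin> S" for a b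
  proof -
    \<comment> \<open>By \<open>A * C = B^2\<close>, the quadratic part multiplied by
      \<open>A\<close> is \<open>T^2\<close>.\<close>
    define T where "T = A * a + B * b"
    have T: "A * B * k \<le> T" using that by (simp add: S_def T_def)
    have "a \<le> A * a" "b \<le> B * b" "0 \<le> A * a" "0 \<le> B * b"
      using that \<open>A > 0\<close> \<open>B > 0\<close> by (auto intro: le_mult_pos_int)
    then have "a \<le> T" "b \<le> T" by (auto simp: T_def)
    have "- p * a \<le> \<bar>p\<bar> * T" using \<open>a \<le> T\<close> \<open>0 \<le> a\<close> by (intro mult_mono) auto
    moreover have "- r * b \<le> \<bar>r\<bar> * T" using \<open>b \<le> T\<close> \<open>0 \<le> b\<close> by (intro mult_mono) auto
    ultimately have lin: "- (m * T) - \<bar>f\<bar> \<le> p * a + r * b + f"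
      by (simp add: m_def algebra_simps)
    have "0 \<le> A * B * k" using \<open>A > 0\<close> \<open>B > 0\<close> k by simp
    with T have "0 \<le> T" by linarith
    then have "A * B * k * (A * B * k - A * m) \<le> T * (T - A * m)"
      using T Amk by (intro mult_mono diff_right_mono)
    then have "A * V \<le> T * (T - A * m) - A * \<bar>f\<bar>"
      by (simp add: V_def algebra_simps)
    also have "\<dots> = T^2 + A * (- (m * T) - \<bar>f\<bar>)"
      by (simp add: power2_eq_square algebra_simps)
    also have "\<dots> \<le> T^2 + A * (p * a + r * b + f)"
      using lin \<open>A > 0\<close> by simp
    also have "T^2 = A * (A * a^2 + 2 * B * a * b) + B^2 * b^2"
      by (simp add: T_def power2_eq_square algebra_simps)
    also have "A * (A * a^2 + 2 * B * a * b) + B^2 * b^2 + A * (p * a + r * b + f)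
        = A * quad A B C p r f a b"
      by (simp add: quad_def deg[symmetric] algebra_simps)
    finally show ?thesis using \<open>A > 0\<close> by simp
  qed
  \<comment> \<open>Even values below \<open>V\<close> are attained only in \<open>S\<close>, so
    \<open>S\<close> has at least \<open>V div 2\<close> points; the rounding accounts for the later
    \<open>V - 1\<close>.\<close>
  have "(\<lambda>i. 2 * i) ` {0..<V div 2} \<subseteq> (\<lambda>(a, b). quad A B C p r f a b) ` S"
  proof (clarify)
    fix i assume i: "i \<in> {0..<V div 2}"
    then obtain a b where "0 \<le> a" "0 \<le> b" "quad A B C p r f a b = 2 * i"
      using quad_ontoE[OF onto, of "2 * i"] by auto
    moreover have "2 * i < V" using i by auto
    ultimately show "2 * i \<in> (\<lambda>(a, b). quad A B C p r f a b) ` S"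
      using big[of a b] by force
  qed
  then have "card ((\<lambda>i. 2 * i) ` {0..<V div 2}) \<le> card S"
    using card_lattice_triangle_le(1)[of A B k] \<open>A > 0\<close> \<open>B > 0\<close> k
    by (intro surj_card_le) (auto simp: S_def)
  moreover have "card ((\<lambda>i. 2 * i) ` {0..<V div 2}) = nat (V div 2)"
    by (subst card_image) (auto intro: inj_onI)
  ultimately have "V - 1 \<le> 2 * int (card S)" by linarith
  also have "\<dots> \<le> (B * k + 1) * (A * k + 2)"
    unfolding S_def using \<open>A > 0\<close> \<open>B > 0\<close> k by (intro card_lattice_triangle_le(2)) auto
  finally have *: "A * B * k * (B * k) \<le> A * B * k * k + q * k + 3 + \<bar>f\<bar>"
    by (simp add: V_def q_def algebra_simps)
  \<comment> \<open>Here \<open>B \<ge> 2\<close> enters: the left side of \<open>*\<close> is at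
    least twice the leading term on the right.\<close>
  have "A * B * k * (2 * k) \<le> A * B * k * (B * k)"
    using \<open>A > 0\<close> \<open>B \<ge> 2\<close> k by (intro mult_left_mono mult_right_mono) auto
  with * have "A * B * (k * k) \<le> q * k + 3 + \<bar>f\<bar>" by (simp add: algebra_simps)
  moreover have "k * k \<le> A * B * (k * k)"
    using \<open>A * B \<ge> 1\<close> k by (intro le_mult_pos_int) auto
  moreover have "k * k = q * k + 4 * k + \<bar>f\<bar> * k" by (simp add: k_def algebra_simps)
  moreover have "\<bar>f\<bar> \<le> \<bar>f\<bar> * k"
    using le_mult_pos_int[of k "\<bar>f\<bar>"] k by (simp add: mult.commute)
  ultimately show False using k by linarith
qed

section \<open>The linear part and the classification on the quadrant\<close>

text \<open>On the diagonal \<open>a + b = t\<close> the values rise by \<open>2 * e\<close> per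
  step in \<open>b\<close>, and the first value of the next diagonal is \<open>2 * (t + D)\<close>
  above the first value of this one. A collision occurs if \<open>e * b = t + D\<close>; excluding
  it gives \<open>e = 1\<close> and \<open>D \<ge> 1\<close>, and attaining \<open>f + 2\<close> and
  \<open>0\<close> gives the rest.\<close>

lemma quad_cantor_ordered:
  assumes inj: "quad_inj 1 1 1 p r f" and onto: "quad_onto 1 1 1 p r f" and "p < r"
  shows "p = 1 \<and> r = 3 \<and> f = 0"
proof -
  have f: "f \<ge> 0" "even f" using quad_ontoD[OF onto, of 0 0] by (simp_all add: quad_def)
  have "odd p" using quad_ontoD(2)[OF onto, of 1 0] f by (simp add: quad_def)
  then obtain d where "p = 2 * d + 1" by (elim oddE)
  define D where "D = d + 1"
  have p: "p = 2 * D - 1" using \<open>p = 2 * d + 1\<close> by (simp add: D_def)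
  have "odd r" using quad_ontoD(2)[OF onto, of 0 1] f by (simp add: quad_def)
  then have "even (r - p)" using \<open>odd p\<close> by simp
  then obtain e where "r - p = 2 * e" by (elim evenE)
  then have r: "r = 2 * D - 1 + 2 * e" using p by simp
  have e: "e \<ge> 1" using \<open>p < r\<close> p r by simp
  have val: "quad 1 1 1 p r f a b = (a + b)^2 + (2 * D - 1) * (a + b) + 2 * e * b + f" for a b
    by (simp add: quad_def p r power2_eq_square algebra_simps)
  have no_collision: False if "0 \<le> b" "b \<le> e * b - D" for b
  proof -
    \<comment> \<open>The diagonal on which the point at height \<open>b\<close> meets the start of
      the next one; \<open>b \<le> t\<close> puts that point in the quadrant.\<close>
    define t where "t = e * b - D"
    have "quad 1 1 1 p r f (t - b) b = quad 1 1 1 p r f (t + 1) 0"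
      unfolding val by (simp add: t_def power2_eq_square algebra_simps)
    from quad_injD(1)[OF inj this] that show False by (simp add: t_def)
  qed
  have "e = 1"
  proof (rule ccontr)
    assume "e \<noteq> 1"
    then have "2 * \<bar>D\<bar> \<le> e * \<bar>D\<bar>" using e by (intro mult_right_mono) auto
    then have "\<bar>D\<bar> \<le> e * \<bar>D\<bar> - D" by linarith
    then show False using no_collision[of "\<bar>D\<bar>"] by simp
  qed
  have "D \<ge> 1" using no_collision[of 0] by force
  have low: "a = 0 \<and> b = 0 \<or> f + 2 * D \<le> quad 1 1 1 p r f a b" if "0 \<le> a" "0 \<le> b" for a b
  proof (cases "a + b \<ge> 1")
    case True
    then have "1 \<le> (a + b)^2" by (simp add: one_le_power)
    moreover have "(2 * D - 1) * 1 \<le> (2 * D - 1) * (a + b)"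
      using True \<open>D \<ge> 1\<close> by (intro mult_left_mono) auto
    ultimately show ?thesis using \<open>0 \<le> b\<close> by (simp add: val \<open>e = 1\<close>)
  qed (use that in auto)
  have "D = 1"
  proof (rule ccontr)
    assume "D \<noteq> 1"
    obtain a b where "0 \<le> a" "0 \<le> b" "quad 1 1 1 p r f a b = f + 2"
      using quad_ontoE[OF onto, of "f + 2"] f by auto
    with low[of a b] \<open>D \<ge> 1\<close> \<open>D \<noteq> 1\<close> show False by (auto simp: quad_def)
  qed
  moreover obtain a b where "0 \<le> a" "0 \<le> b" "quad 1 1 1 p r f a b = 0"
    using quad_ontoE[OF onto, of 0] by auto
  with low[of a b] \<open>D \<ge> 1\<close> f have "f = 0" by (auto simp: quad_def)
  ultimately show ?thesis using p r \<open>e = 1\<close> by simp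
qed

theorem fueter_polya_quadratic:
  assumes inj: "quad_inj A B C p r f" and onto: "quad_onto A B C p r f"
    and nz: "A \<noteq> 0 \<or> B \<noteq> 0 \<or> C \<noteq> 0"
  shows "A = 1 \<and> B = 1 \<and> C = 1 \<and> f = 0 \<and> (p = 1 \<and> r = 3 \<or> p = 3 \<and> r = 1)"
proof -
  note inj' = quad_inj_swap[OF inj] and onto' = quad_onto_swap[OF onto]
  have deg: "A * C = B^2" by (rule quad_inj_degenerate[OF inj])
  have "A \<ge> 0" "C \<ge> 0"
    using quad_onto_leading_nonneg[OF onto] quad_onto_leading_nonneg[OF onto'] .
  \<comment> \<open>If \<open>B = 0\<close>, then \<open>A\<close> or \<open>C\<close> vanishes, and
    the lemma on nonzero coefficients with its mirror image makes both vanish.\<close>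
  have "B \<noteq> 0"
  proof
    assume "B = 0"
    then have "A = 0 \<or> C = 0" using deg by simp
    with nz \<open>B = 0\<close> \<open>A \<ge> 0\<close> \<open>C \<ge> 0\<close> quad_inj_nonzero_right[of A C p r f]
      quad_inj_nonzero_right[of C A r p f] inj inj' show False by auto
  qed
  then have "A * C > 0" using deg by simp
  then have "A > 0" "C > 0" using \<open>A \<ge> 0\<close> \<open>C \<ge> 0\<close> by (auto simp: zero_less_mult_iff)
  have "B > 0" using quad_inj_cross_nonneg[OF inj \<open>A > 0\<close>] \<open>B \<noteq> 0\<close> by simp
  have "B = 1" by (rule quad_onto_parabolic_cross_eq_1[OF onto deg \<open>A > 0\<close> \<open>B > 0\<close>])
  then have "A = 1" "C = 1" using deg \<open>A > 0\<close> \<open>C > 0\<close> by (simp_all add: zmult_eq_1_iff)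
  have "p \<noteq> r"
    using quad_injD(1)[OF inj, of 1 0 0 1] \<open>A = 1\<close> \<open>C = 1\<close> by (auto simp: quad_def)
  then consider "p < r" | "r < p" by linarith
  then show ?thesis
    using quad_cantor_ordered[of p r f] quad_cantor_ordered[of r p f]
      inj onto inj' onto' \<open>A = 1\<close> \<open>B = 1\<close> \<open>C = 1\<close> by cases auto
qed

section \<open>Bivariate polynomials of total degree two\<close>

lemma total_degree_le_iff:
  "total_degree p \<le> n \<longleftrightarrow> (\<forall>i j. n < i + j \<longrightarrow> coeff (coeff p j) i = 0)"
proof -
  have "total_degree p \<le> n \<longleftrightarrow> (\<forall>d\<in>monomial_degrees p. d \<le> n)"
    unfolding total_degree_def by (subst Max_le_iff) (auto simp: finite_monomial_degrees)
  also have "\<dots> \<longleftrightarrow> (\<forall>i j. n < i + j \<longrightarrow> coeff (coeff p j) i = 0)"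
    by (auto simp: monomial_degrees_def not_less[symmetric])
  finally show ?thesis .
qed

lemma quadratic_poly_poly_eq:
  assumes "total_degree p \<le> 2"
  obtains c00 c10 c20 c01 c11 c02
  where "p = [:[:c00, c10, c20:], [:c01, c11:], [:c02:]:]"
proof
  let ?c = "\<lambda>i j. coeff (coeff p j) i"
  have z: "?c i j = 0" if "2 < i + j" for i j
    using assms that by (simp add: total_degree_le_iff)
  show "p = [:[:?c 0 0, ?c 1 0, ?c 2 0:], [:?c 0 1, ?c 1 1:], [:?c 0 2:]:]"
    by (intro poly_eqI) (auto simp: coeff_pCons z numeral_2_eq_2 split: nat.splits)
qed

lemma total_degree_quadratic:
  "total_degree [:[:c00, c10, c20:], [:c01, c11:], [:c02:]:] = 2
     \<longleftrightarrow> c20 \<noteq> 0 \<or> c11 \<noteq> 0 \<or> c02 \<noteq> 0"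
  (is "total_degree ?p = 2 \<longleftrightarrow> _")
proof -
  have "total_degree ?p \<le> 2"
    by (auto simp: total_degree_le_iff coeff_pCons split: nat.splits)
  moreover have "total_degree ?p \<le> 1 \<longleftrightarrow> c20 = 0 \<and> c11 = 0 \<and> c02 = 0"
  proof
    assume *: "total_degree ?p \<le> 1"
    show "c20 = 0 \<and> c11 = 0 \<and> c02 = 0"
      using *[unfolded total_degree_le_iff, rule_format, of 2 0]
        *[unfolded total_degree_le_iff, rule_format, of 1 1]
        *[unfolded total_degree_le_iff, rule_format, of 0 2]
      by (simp add: numeral_2_eq_2)
  qed (auto simp: total_degree_le_iff coeff_pCons split: nat.splits)
  ultimately show ?thesis by auto
qed

lemma F_inv_eq:
  "F_inv s = [:[:0, 1/2, 1/2:], [:(3 - of_int s) / 2, 1 - of_int s:], [:(of_int s - 1)^2 / 2:]:]"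
  by (simp add: F_inv_def var_x_def var_y_def of_int_poly power2_eq_square field_simps)

lemma G_inv_eq:
  "G_inv s = [:[:0, 3/2, 1/2:], [:(1 - 3 * of_int s) / 2, 1 - of_int s:], [:(of_int s - 1)^2 / 2:]:]"
  by (simp add: G_inv_def var_x_def var_y_def of_int_poly numeral_poly power2_eq_square field_simps)

section \<open>Passage from the sector to the quadrant\<close>

text \<open>Precomposition with the shear \<open>\<phi>\<close>. Integer coordinates let its inverse
  subtract \<open>s * y\<close> without truncation.\<close>

lemma packing_polynomial_sector_iff:
  fixes s :: int
  assumes "s > 0"
  shows "packing_polynomial p (sector (1 / real_of_int s)) \<longleftrightarrow>
    bij_betw (\<lambda>(a, b). eval2 p (of_int (a + s * b)) (of_int b)) ({0..} \<times> {0..}) (\<nat> :: real set)"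
proof -
  define \<phi> where "\<phi> = (\<lambda>(a, b). (nat (a + s * b), nat b))"
  have sec: "(x, y) \<in> sector (1 / real_of_int s) \<longleftrightarrow> s * int y \<le> int x" for x y
  proof -
    have "(x, y) \<in> sector (1 / real_of_int s) \<longleftrightarrow> real_of_int (s * int y) \<le> real_of_int (int x)"
      using assms by (simp add: sector_def field_simps)
    then show ?thesis by (simp only: of_int_le_iff)
  qed
  have bij: "bij_betw \<phi> ({0..} \<times> {0..}) (sector (1 / real_of_int s))"
  proof (rule bij_betwI[where g = "\<lambda>(x, y). (int x - s * int y, int y)"])
    show "\<phi> \<in> {0..} \<times> {0..} \<rightarrow> sector (1 / real_of_int s)"
      using assms by (auto simp: \<phi>_def sec)
  qed (use assms in \<open>auto simp: \<phi>_def sec\<close>)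
  show ?thesis
    unfolding packing_polynomial_def bij_betw_comp_iff[OF bij]
    by (intro bij_betw_cong) (use assms in \<open>auto simp: \<phi>_def\<close>)
qed

lemma eval2_quadratic:
  "eval2 [:[:c00, c10, c20:], [:c01, c11:], [:c02:]:] x y
     = c20 * x^2 + c11 * x * y + c02 * y^2 + c10 * x + c01 * y + c00"
  by (simp add: eval2_def power2_eq_square algebra_simps)

section \<open>The two Cantor polynomials\<close>

lemma bij_betw_nonneg_int_swap:
  fixes f :: "int \<Rightarrow> int \<Rightarrow> real"
  assumes "bij_betw (\<lambda>(a, b). f a b) ({0..} \<times> {0..}) N"
  shows "bij_betw (\<lambda>(a, b). f b a) ({0..} \<times> {0..}) N"
proof -
  have "bij_betw prod.swap ({0..} \<times> {0..}) ({0::int..} \<times> {0::int..})"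
    by (rule bij_betwI[where g = prod.swap]) auto
  from bij_betw_trans[OF this assms] show ?thesis
    by (simp add: o_def case_prod_unfold)
qed

text \<open>This is the pairing function \<open>prod_encode\<close> at \<open>(b, a)\<close>, that
  is, \<open>triangle (a + b) + b\<close>.\<close>

lemma bij_cantor:
  "bij_betw (\<lambda>(a, b). (of_int (a + b)^2 + of_int (a + 3 * b)) / 2)
     ({0::int..} \<times> {0::int..}) (\<nat> :: real set)"
proof -
  have 1: "bij_betw (\<lambda>(a, b). (nat b, nat a)) ({0..} \<times> {0..}) (UNIV :: (nat \<times> nat) set)"
    by (rule bij_betwI[where g = "\<lambda>(m, n). (int n, int m)"]) auto
  have 2: "bij_betw (of_nat :: nat \<Rightarrow> real) UNIV \<nat>"
    by (auto simp: bij_betw_def Nats_def inj_on_def)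
  have tri: "real (triangle n) = (real n^2 + real n) / 2" for n
    by (induction n) (simp_all add: power2_eq_square field_simps)
  show ?thesis
    by (rule bij_betw_cong[THEN iffD1, OF _ bij_betw_trans[OF bij_betw_trans[OF 1 bij_prod_encode] 2]])
       (auto simp: prod_encode_def tri power2_eq_square field_simps)
qed

text \<open>The shear turns \<open>x - (s - 1) * y\<close> into \<open>a + b\<close> and
  \<open>x + (3 - s) * y\<close> into \<open>a + 3 * b\<close>.\<close>

lemma F_inv_in:
  assumes "s > 0"
  shows "F_inv s \<in> quadratic_packing_polynomials (sector (1 / real_of_int s))"
proof -
  have "eval2 (F_inv s) (of_int (a + s * b)) (of_int b)
      = (of_int (a + b)^2 + of_int (a + 3 * b)) / 2" for a b
    by (simp add: eval2_F_inv power2_eq_square field_simps)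
  then have "packing_polynomial (F_inv s) (sector (1 / real_of_int s))"
    unfolding packing_polynomial_sector_iff[OF assms] using bij_cantor by (simp only:)
  then show ?thesis
    by (simp add: quadratic_packing_polynomials_def F_inv_eq total_degree_quadratic)
qed

lemma G_inv_in:
  assumes "s > 0"
  shows "G_inv s \<in> quadratic_packing_polynomials (sector (1 / real_of_int s))"
proof -
  have "eval2 (G_inv s) (of_int (a + s * b)) (of_int b)
      = (of_int (b + a)^2 + of_int (b + 3 * a)) / 2" for a b
    by (simp add: eval2_G_inv power2_eq_square field_simps)
  then have "packing_polynomial (G_inv s) (sector (1 / real_of_int s))"
    unfolding packing_polynomial_sector_iff[OF assms]
    using bij_betw_nonneg_int_swap[OF bij_cantor] by (simp only:)
  then show ?thesis
    by (simp add: quadratic_packing_polynomials_def G_inv_eq total_degree_quadratic)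
qed

section \<open>Integrality and uniqueness\<close>

text \<open>Halving is injective and carries the nonnegative even integers onto
  \<open>\<nat>\<close>.\<close>

lemma bij_betw_half_quad:
  assumes "bij_betw (\<lambda>(a, b). real_of_int (quad A B C p r f a b) / 2) ({0..} \<times> {0..}) \<nat>"
  shows "quad_inj A B C p r f" "quad_onto A B C p r f"
proof -
  let ?W = "\<lambda>(a, b). quad A B C p r f a b"
  have h: "(\<lambda>(a, b). real_of_int (quad A B C p r f a b) / 2) = (\<lambda>n. real_of_int n / 2) \<circ> ?W"
    by auto
  from assms have inj: "inj_on ((\<lambda>n. real_of_int n / 2) \<circ> ?W) ({0..} \<times> {0..})"
    and img: "(\<lambda>n. real_of_int n / 2) ` ?W ` ({0..} \<times> {0..}) = \<nat>"
    unfolding h by (simp_all add: bij_betw_def image_comp)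
  show "quad_inj A B C p r f"
    unfolding quad_inj_def by (rule inj_on_imageI2[OF inj])
  have "(\<lambda>n. real_of_int n / 2) ` {n. 0 \<le> n \<and> even n} = \<nat>"
  proof (intro equalityI subsetI)
    fix x :: real assume "x \<in> \<nat>"
    then obtain n where "x = of_nat n" by (elim Nats_cases)
    then show "x \<in> (\<lambda>n. real_of_int n / 2) ` {n. 0 \<le> n \<and> even n}"
      by (intro image_eqI[of _ _ "2 * int n"]) auto
  next
    fix x assume "x \<in> (\<lambda>n. real_of_int n / 2) ` {n. 0 \<le> n \<and> even n}"
    then obtain k where "0 \<le> k" "x = real_of_int k" by (auto elim: evenE)
    then have "x = of_nat (nat k)" by simp
    then show "x \<in> \<nat>" by simp
  qed
  moreover have "inj (\<lambda>n. real_of_int n / 2)" by (auto intro: injI)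
  ultimately show "quad_onto A B C p r f"
    unfolding quad_onto_def by (subst inj_image_eq_iff[symmetric]) (assumption, simp only: img)
qed

text \<open>Finite differences at six points recover the coefficients. The mixed difference yields
  \<open>q11\<close> undoubled, which is why \<open>quad\<close> carries
  \<open>2 * B\<close>.\<close>

lemma quadratic_on_quadrant_integral:
  fixes u :: "int \<Rightarrow> int \<Rightarrow> real"
  assumes u: "\<And>a b. u a b = q20 * of_int a^2 + q11 * of_int a * of_int b + q02 * of_int b^2
      + q10 * of_int a + q01 * of_int b + q00"
    and Z: "\<And>a b. 0 \<le> a \<Longrightarrow> 0 \<le> b \<Longrightarrow> u a b \<in> \<int>"
  obtains A B C p r f :: int
  where "2 * q20 = of_int A" "q11 = of_int B" "2 * q02 = of_int C"
    and "2 * q10 = of_int p" "2 * q01 = of_int r" "2 * q00 = of_int f"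
proof -
  have "2 * q20 = u 2 0 - 2 * u 1 0 + u 0 0" "q11 = u 1 1 - u 1 0 - u 0 1 + u 0 0"
    "2 * q02 = u 0 2 - 2 * u 0 1 + u 0 0"
    "2 * q10 = 4 * u 1 0 - 3 * u 0 0 - u 2 0" "2 * q01 = 4 * u 0 1 - 3 * u 0 0 - u 0 2"
    "2 * q00 = 2 * u 0 0"
    by (simp_all add: u)
  moreover have "u 2 0 \<in> \<int>" "u 1 0 \<in> \<int>" "u 0 0 \<in> \<int>" "u 1 1 \<in> \<int>" "u 0 1 \<in> \<int>" "u 0 2 \<in> \<int>"
    by (auto intro: Z)
  ultimately have "2 * q20 \<in> \<int>" "q11 \<in> \<int>" "2 * q02 \<in> \<int>" "2 * q10 \<in> \<int>" "2 * q01 \<in> \<int>"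
    "2 * q00 \<in> \<int>"
    by simp_all
  then show thesis using that by (metis Ints_cases)
qed

theorem theorem11:
  fixes s :: int
  assumes "s \<ge> 2"
  shows "quadratic_packing_polynomials (sector (1 / real_of_int s)) = {F_inv s, G_inv s}"
proof
  have "s > 0" using assms by simp
  show "{F_inv s, G_inv s} \<subseteq> quadratic_packing_polynomials (sector (1 / real_of_int s))"
    using F_inv_in G_inv_in \<open>s > 0\<close> by simp
  show "quadratic_packing_polynomials (sector (1 / real_of_int s)) \<subseteq> {F_inv s, G_inv s}"
  proof
    fix P assume "P \<in> quadratic_packing_polynomials (sector (1 / real_of_int s))"
    then have deg: "total_degree P = 2"
      and pack: "packing_polynomial P (sector (1 / real_of_int s))"
      by (auto simp: quadratic_packing_polynomials_def)
    obtain c00 c10 c20 c01 c11 c02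
      where P: "P = [:[:c00, c10, c20:], [:c01, c11:], [:c02:]:]"
      using quadratic_poly_poly_eq deg by (metis order_refl)
    have nz: "c20 \<noteq> 0 \<or> c11 \<noteq> 0 \<or> c02 \<noteq> 0"
      using deg by (simp add: P total_degree_quadratic)
    define S where "S = real_of_int s"
    define u where "u = (\<lambda>a b. eval2 P (of_int (a + s * b)) (of_int b))"
    have u: "u a b = c20 * of_int a^2 + (2 * S * c20 + c11) * of_int a * of_int b
        + (c20 * S^2 + c11 * S + c02) * of_int b^2
        + c10 * of_int a + (c10 * S + c01) * of_int b + c00" for a b
      by (simp add: u_def P eval2_quadratic S_def power2_eq_square algebra_simps)
    have bij: "bij_betw (\<lambda>(a, b). u a b) ({0..} \<times> {0..}) \<nat>"
      using pack by (simp add: packing_polynomial_sector_iff[OF \<open>s > 0\<close>] u_def)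
    have "u a b \<in> \<int>" if "0 \<le> a" "0 \<le> b" for a b
      using bij_betw_apply[OF bij, of "(a, b)"] that by (auto simp: Nats_subset_Ints[THEN subsetD])
    then obtain A B C p r f :: int
      where A: "2 * c20 = of_int A" and B: "2 * S * c20 + c11 = of_int B"
        and C: "2 * (c20 * S^2 + c11 * S + c02) = of_int C"
        and p: "2 * c10 = of_int p" and r: "2 * (c10 * S + c01) = of_int r"
        and f: "2 * c00 = of_int f"
      using quadratic_on_quadrant_integral[OF u] by metis
    have "u a b = real_of_int (quad A B C p r f a b) / 2" for a b
      unfolding quad_def of_int_add of_int_mult of_int_power of_int_numeral
        A[symmetric] B[symmetric] C[symmetric] p[symmetric] r[symmetric] f[symmetric] u
      by (simp add: field_simps)
    then have "bij_betw (\<lambda>(a, b). real_of_int (quad A B C p r f a b) / 2) ({0..} \<times> {0..}) \<nat>"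
      using bij by (simp only:)
    note q = bij_betw_half_quad[OF this]
    \<comment> \<open>The shear is invertible, so it cannot annihilate the quadratic part.\<close>
    have "A \<noteq> 0 \<or> B \<noteq> 0 \<or> C \<noteq> 0" using nz A B C by auto
    from fueter_polya_quadratic[OF q this]
    have 1: "A = 1" "B = 1" "C = 1" "f = 0" and pr: "p = 1 \<and> r = 3 \<or> p = 3 \<and> r = 1"
      by auto
    \<comment> \<open>From here the shear is undone coefficient by coefficient.\<close>
    have c: "c20 = 1/2" "c00 = 0" using A f 1 by simp_all
    have c11: "c11 = 1 - S" using B 1 unfolding c(1) by simp
    have c02: "c02 = (S - 1)^2 / 2"
      using C 1 c c11 by (simp add: power2_eq_square field_simps)
    from pr show "P \<in> {F_inv s, G_inv s}"
    proof
      assume "p = 1 \<and> r = 3"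
      then have "c10 = 1/2" "c01 = (3 - S) / 2" using p r by (simp_all add: field_simps)
      then show ?thesis using c c11 c02 by (simp add: P F_inv_eq S_def)
    next
      assume "p = 3 \<and> r = 1"
      then have "c10 = 3/2" "c01 = (1 - 3 * S) / 2" using p r by (simp_all add: field_simps)
      then show ?thesis using c c11 c02 by (simp add: P G_inv_eq S_def)
    qed
  qed
qed

end
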